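(* Let $\mathcal Q(C_a,C_b)$ be a hypergraph product code with the logical Pauli operators given by SLT bases. All block matrices below have row and column blocks of sizes $\tilde n,\tilde m,\tilde n,\tilde m$. (i) For distinct left-sector logical qubits $(i_1,h_1,L)\neq(i_2,h_2,L)$, the two-qubit targeted logical CZ between them has the symplectic representation $$F^{CZ}_{(i_1,h_1,L)\leftrightarrow(i_2,h_2,L)}=\begin{bmatrix}I_{\tilde n}&0&\tilde B&0\\0&I_{\tilde m}&0&0\\0&0&I_{\tilde n}&0\\0&0&0&I_{\tilde m}\end{bmatrix},$$ where $\tilde B=(a_{i_1}\otimes e_{h_1})^{\top}(a_{i_2}\otimes e_{h_2})+(a_{i_2}\otimes e_{h_2})^{\top}(a_{i_1}\otimes e_{h_1})$. (ii) For a left-sector logical qubit $(i,h,L)$ and a right-sector logical qubit $(j,l,R)$, the targeted logical CZ between them has the symplectic representation $$F^{CZ}_{(i,h,L)\leftrightarrow(j,l,R)}=\begin{bmatrix}I_{\tilde n}&0&0&\tilde B\\0&I_{\tilde m}&\tilde B^{\top}&0\\0&0&I_{\tilde n}&0\\0&0&0&I_{\tilde m}\end{bmatrix},\qquad \tilde B=(a_i\otimes e_h)^{\top}(e_j\otimes\beta_l).$$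
   Context: All vectors are row vectors over $\mathbb F_2$; $e_i$ denotes a standard basis vector of the appropriate length. Given binary matrices $H_a$ ($m_a\times n_a$) and $H_b$ ($m_b\times n_b$), parity-check matrices of classical codes $C_a=\ker H_a$, $C_b=\ker H_b$, the hypergraph product (HGP) code $\mathcal Q(C_a,C_b)$ is the CSS code on $n=\tilde n+\tilde m$ qubits, $\tilde n=n_an_b$, $\tilde m=m_am_b$, with $$H_X=[H_a\otimes I_{n_b}\,|\,I_{m_a}\otimes H_b^{\top}],\qquad H_Z=[I_{n_a}\otimes H_b\,|\,H_a^{\top}\otimes I_{m_b}].$$ The first $\tilde n$ qubits form the left sector, the last $\tilde m$ the right sector. Stabilizer generators correspond to the vectors $[H_X(r,:),0]$, $[0,H_Z(r,:)]$ in $\mathbb F_2^{2n}$, where $[a,b]$ represents up to phase the Pauli operator $X^{a_1}Z^{b_1}\otimes\cdots\otimes X^{a_n}Z^{b_n}$. An SLT basis of a subspace is a basis $\{a_i\}$ whose vectors are indexed by distinct coordinates $i$ (pivots) such that $(a_i)_i=1$ and $(a_{i'})_i=0$ for pivots $i'\ne i$. Let $\{a_i\},\{\alpha_j\},\{b_h\},\{\beta_l\}$ be SLT bases of $\ker H_a,\ker H_a^{\top},\ker H_b,\ker H_b^{\top}$. Logical qubits are labelled $(i,h,L)$ ($i$ a pivot of $\{a_i\}$, $h$ a pivot of $\{b_h\}$) and $(j,l,R)$ ($j$ a pivot of $\{\alpha_j\}$, $l$ a pivot of $\{\beta_l\}$). Logical Paulis: $\overline X_{i,h,L}$ is the $X$-type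 operator with vector $[\,e_i\otimes b_h\,|\,0\,]$, $\overline Z_{i,h,L}$ the $Z$-type operator with vector $[\,a_i\otimes e_h\,|\,0\,]$, $\overline X_{j,l,R}$ the $X$-type operator with vector $[\,0\,|\,\alpha_j\otimes e_l\,]$, $\overline Z_{j,l,R}$ the $Z$-type operator with vector $[\,0\,|\,e_j\otimes\beta_l\,]$. A matrix $F$ is a symplectic representation of a logical gate $g$ if $F\Omega F^{\top}=\Omega$ with $\Omega=\begin{bmatrix}0 & I_n \\ I_n & 0\end{bmatrix}$, right multiplication by $F$ fixes every stabilizer generator vector, and it maps the vectors in $\mathbb F_2^{2n}$ of the logical Paulis as $g$ prescribes modulo phases. The logical CZ between $p$ and $q$ maps $\overline X_p\mapsto\overline X_p\overline Z_q$, $\overline X_q\mapsto\overline Z_p\overline X_q$, and fixes all other logical Paulis $\overline X,\overline Z$. *)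

theory Defs
  imports "HOL-Library.Z2" "Jordan_Normal_Form.Matrix_Kernel"
begin

text \<open>
  The field with two elements is the type \<^typ>\<open>bit\<close>. Coordinates are numbered from 0.
  A vector is always read as a row vector: the product of the row vector \<open>v\<close> with a matrix
  \<open>F\<close> is \<open>mat_of_row v * F\<close>, and \<open>u\<^sup>T v\<close> is \<open>outer_prod u v\<close> below.
\<close>

definition kron_mat :: "'a::times mat \<Rightarrow> 'a mat \<Rightarrow> 'a mat" where
  "kron_mat A B = mat (dim_row A * dim_row B) (dim_col A * dim_col B)
     (\<lambda>(r, c). A $$ (r div dim_row B, c div dim_col B) * B $$ (r mod dim_row B, c mod dim_col B))"

definition kron_vec :: "'a::times vec \<Rightarrow> 'a vec \<Rightarrow> 'a vec" where
  "kron_vec u v = vec (dim_vec u * dim_vec v) (\<lambda>k. u $ (k div dim_vec v) * v $ (k mod dim_vec v))"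

definition outer_prod :: "'a::semiring_0 vec \<Rightarrow> 'a vec \<Rightarrow> 'a mat" where
  "outer_prod u v = transpose_mat (mat_of_row u) * mat_of_row v"

text \<open>The matrix \<open>[A | B]\<close>, for \<open>A\<close> and \<open>B\<close> with the same number of rows.\<close>

definition beside :: "'a::zero mat \<Rightarrow> 'a mat \<Rightarrow> 'a mat" where
  "beside A B = four_block_mat A B (0\<^sub>m 0 (dim_col A)) (0\<^sub>m 0 (dim_col B))"


subsection \<open>Hypergraph product codes\<close>

definition num_left :: "bit mat \<Rightarrow> bit mat \<Rightarrow> nat" where
  "num_left Ha Hb = dim_col Ha * dim_col Hb"

definition num_right :: "bit mat \<Rightarrow> bit mat \<Rightarrow> nat" where
  "num_right Ha Hb = dim_row Ha * dim_row Hb"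

definition num_qubits :: "bit mat \<Rightarrow> bit mat \<Rightarrow> nat" where
  "num_qubits Ha Hb = num_left Ha Hb + num_right Ha Hb"

definition hgp_HX :: "bit mat \<Rightarrow> bit mat \<Rightarrow> bit mat" where
  "hgp_HX Ha Hb =
     beside (kron_mat Ha (1\<^sub>m (dim_col Hb))) (kron_mat (1\<^sub>m (dim_row Ha)) (transpose_mat Hb))"

definition hgp_HZ :: "bit mat \<Rightarrow> bit mat \<Rightarrow> bit mat" where
  "hgp_HZ Ha Hb =
     beside (kron_mat (1\<^sub>m (dim_col Ha)) Hb) (kron_mat (transpose_mat Ha) (1\<^sub>m (dim_row Hb)))"

text \<open>
  An \<open>n\<close>-qubit Pauli operator is represented up to phase by the vector \<open>[x, z]\<close> of length \<open>2n\<close>,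
  so multiplication of operators becomes addition of vectors.
\<close>

definition X_type :: "bit vec \<Rightarrow> bit vec" where
  "X_type x = x @\<^sub>v 0\<^sub>v (dim_vec x)"

definition Z_type :: "bit vec \<Rightarrow> bit vec" where
  "Z_type z = 0\<^sub>v (dim_vec z) @\<^sub>v z"

definition hgp_stabilizers :: "bit mat \<Rightarrow> bit mat \<Rightarrow> bit vec set" where
  "hgp_stabilizers Ha Hb =
     {X_type (row (hgp_HX Ha Hb) r) | r. r < dim_row (hgp_HX Ha Hb)} \<union>
     {Z_type (row (hgp_HZ Ha Hb) r) | r. r < dim_row (hgp_HZ Ha Hb)}"


subsection \<open>SLT bases\<close>

text \<open>
  \<open>P\<close> is the set of pivots and \<open>a i\<close> the basis vector indexed by the pivot \<open>i\<close>; values of \<open>a\<close>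
  outside \<open>P\<close> are irrelevant. The pivot conditions make \<open>a\<close> injective on \<open>P\<close>, so nothing is
  lost by passing to the set \<open>a ` P\<close>.
\<close>

definition SLT_basis :: "nat \<Rightarrow> bit vec set \<Rightarrow> nat set \<Rightarrow> (nat \<Rightarrow> bit vec) \<Rightarrow> bool" where
  "SLT_basis n V P a \<longleftrightarrow>
     P \<subseteq> {..<n} \<and>
     vectorspace.basis class_ring ((module_vec TYPE(bit) n)\<lparr>carrier := V\<rparr>) (a ` P) \<and>
     (\<forall>i\<in>P. a i $ i = 1) \<and>
     (\<forall>i\<in>P. \<forall>i'\<in>P. i' \<noteq> i \<longrightarrow> a i' $ i = 0)"


subsection \<open>Logical Pauli operators\<close>

datatype logical_qubit = LeftQ nat nat | RightQ nat nat

datatype logical_pauli = LogX logical_qubit | LogZ logical_qubit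

definition logical_qubits :: "nat set \<Rightarrow> nat set \<Rightarrow> nat set \<Rightarrow> nat set \<Rightarrow> logical_qubit set" where
  "logical_qubits Pa P\<alpha> Pb P\<beta> =
     {LeftQ i h | i h. i \<in> Pa \<and> h \<in> Pb} \<union> {RightQ j l | j l. j \<in> P\<alpha> \<and> l \<in> P\<beta>}"

fun logical_vec :: "bit mat \<Rightarrow> bit mat \<Rightarrow> (nat \<Rightarrow> bit vec) \<Rightarrow> (nat \<Rightarrow> bit vec) \<Rightarrow>
    (nat \<Rightarrow> bit vec) \<Rightarrow> (nat \<Rightarrow> bit vec) \<Rightarrow> logical_pauli \<Rightarrow> bit vec" where
  "logical_vec Ha Hb a \<alpha> b \<beta> (LogX (LeftQ i h)) =
     X_type (kron_vec (unit_vec (dim_col Ha) i) (b h) @\<^sub>v 0\<^sub>v (num_right Ha Hb))"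
| "logical_vec Ha Hb a \<alpha> b \<beta> (LogZ (LeftQ i h)) =
     Z_type (kron_vec (a i) (unit_vec (dim_col Hb) h) @\<^sub>v 0\<^sub>v (num_right Ha Hb))"
| "logical_vec Ha Hb a \<alpha> b \<beta> (LogX (RightQ j l)) =
     X_type (0\<^sub>v (num_left Ha Hb) @\<^sub>v kron_vec (\<alpha> j) (unit_vec (dim_row Hb) l))"
| "logical_vec Ha Hb a \<alpha> b \<beta> (LogZ (RightQ j l)) =
     Z_type (0\<^sub>v (num_left Ha Hb) @\<^sub>v kron_vec (unit_vec (dim_row Ha) j) (\<beta> l))"


subsection \<open>Logical gates and their symplectic representations\<close>

text \<open>
  Modulo phases, a logical gate is prescribed by sending each logical Pauli generator to a
  product of such generators. The product is given as the list of its factors.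
\<close>

type_synonym logical_gate = "logical_pauli \<Rightarrow> logical_pauli list"

definition logical_CZ :: "logical_qubit \<Rightarrow> logical_qubit \<Rightarrow> logical_gate" where
  "logical_CZ p q s =
     (if s = LogX p then [LogX p, LogZ q]
      else if s = LogX q then [LogZ p, LogX q]
      else [s])"

definition product_vec :: "nat \<Rightarrow> (logical_pauli \<Rightarrow> bit vec) \<Rightarrow> logical_pauli list \<Rightarrow> bit vec" where
  "product_vec n v ss = foldr (\<lambda>s w. v s + w) ss (0\<^sub>v (2 * n))"

definition Omega :: "nat \<Rightarrow> bit mat" where
  "Omega n = four_block_mat (0\<^sub>m n n) (1\<^sub>m n) (1\<^sub>m n) (0\<^sub>m n n)"

text \<open>
  Here \<open>S\<close> is the set of stabilizer generator vectors, \<open>Q\<close> the set of logical qubits and \<open>v\<close>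
  assigns to each logical Pauli operator its vector.
\<close>

definition symplectic_rep :: "nat \<Rightarrow> bit vec set \<Rightarrow> logical_qubit set \<Rightarrow>
    (logical_pauli \<Rightarrow> bit vec) \<Rightarrow> logical_gate \<Rightarrow> bit mat \<Rightarrow> bool" where
  "symplectic_rep n S Q v g F \<longleftrightarrow>
     F \<in> carrier_mat (2 * n) (2 * n) \<and>
     F * Omega n * transpose_mat F = Omega n \<and>
     (\<forall>s\<in>S. mat_of_row s * F = mat_of_row s) \<and>
     (\<forall>p \<in> LogX ` Q \<union> LogZ ` Q. mat_of_row (v p) * F = mat_of_row (product_vec n v (g p)))"

definition hgp_symplectic_rep :: "bit mat \<Rightarrow> bit mat \<Rightarrow>
    nat set \<Rightarrow> (nat \<Rightarrow> bit vec) \<Rightarrow> nat set \<Rightarrow> (nat \<Rightarrow> bit vec) \<Rightarrow>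
    nat set \<Rightarrow> (nat \<Rightarrow> bit vec) \<Rightarrow> nat set \<Rightarrow> (nat \<Rightarrow> bit vec) \<Rightarrow>
    logical_gate \<Rightarrow> bit mat \<Rightarrow> bool" where
  "hgp_symplectic_rep Ha Hb Pa a P\<alpha> \<alpha> Pb b P\<beta> \<beta> g F \<longleftrightarrow>
     symplectic_rep (num_qubits Ha Hb) (hgp_stabilizers Ha Hb) (logical_qubits Pa P\<alpha> Pb P\<beta>)
       (logical_vec Ha Hb a \<alpha> b \<beta>) g F"

end

theory Submission
  imports Defs
begin

text \<open>
  Write \<open>z\<^sub>p\<close> and \<open>z\<^sub>q\<close> for the supports of the logical operators \<open>Z\<close> on the two target qubits.
  Both matrices of the proposition have the form \<open>[I, M; 0, I]\<close> with the symmetric matrix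
  \<open>M = z\<^sub>p\<^sup>T z\<^sub>q + z\<^sub>q\<^sup>T z\<^sub>p\<close>. Such a matrix is symplectic, fixes all \<open>Z\<close>-type operators, and sends
  the \<open>X\<close>-type operator \<open>[x, 0]\<close> to \<open>[x, (x \<bullet> z\<^sub>p) z\<^sub>q + (x \<bullet> z\<^sub>q) z\<^sub>p]\<close>. So it suffices that the
  rows of \<open>H\<^sub>X\<close> are orthogonal to the \<open>z\<^sub>t\<close> and that \<open>x\<^sub>s \<bullet> z\<^sub>t = \<delta>\<^sub>s\<^sub>t\<close> for the logical operators; both
  follow from \<open>(u \<otimes> v) \<bullet> (u' \<otimes> v') = (u \<bullet> u') (v \<bullet> v')\<close>.
\<close>

section \<open>Kronecker products, block rows and outer products\<close>

lemma dim_kron_vec [simp]: "dim_vec (kron_vec u v) = dim_vec u * dim_vec v"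
  by (simp add: kron_vec_def)

lemma kron_vec_carrier [simp]:
  "u \<in> carrier_vec m \<Longrightarrow> v \<in> carrier_vec n \<Longrightarrow> kron_vec u v \<in> carrier_vec (m * n)"
  by (rule carrier_vecI) simp

lemma div_mod_less_mult:
  fixes k m n :: nat
  assumes "k < m * n"
  shows "k div n < m" "k mod n < n"
proof -
  have "0 < n" using assms by (cases n) auto
  then show "k div n < m" "k mod n < n" using assms by (simp_all add: less_mult_imp_div_less)
qed

text \<open>The coordinates \<open>k < m * n\<close> correspond to the pairs
  \<open>(k div n, k mod n)\<close>, with inverse \<open>i * n + j\<close>. The sum over
  \<open>k\<close> thus becomes a double sum whose summand separates, and distributivity splits it
  into the two scalar products.\<close>

lemma scalar_prod_kron_vec:
  fixes u u' v v' :: "'a::comm_semiring_0 vec"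
  assumes u: "u \<in> carrier_vec m" and u': "u' \<in> carrier_vec m"
    and v: "v \<in> carrier_vec n" and v': "v' \<in> carrier_vec n"
  shows "kron_vec u v \<bullet> kron_vec u' v' = (u \<bullet> u') * (v \<bullet> v')"
proof -
  have [simp]: "dim_vec u = m" "dim_vec u' = m" "dim_vec v = n" "dim_vec v' = n"
    using assms by auto
  have "kron_vec u v \<bullet> kron_vec u' v' =
      (\<Sum>k<m * n. (u $ (k div n) * u' $ (k div n)) * (v $ (k mod n) * v' $ (k mod n)))"
    by (simp add: scalar_prod_def kron_vec_def atLeast0LessThan mult_ac)
  also have "\<dots> = (\<Sum>(i, j)\<in>{..<m} \<times> {..<n}. (u $ i * u' $ i) * (v $ j * v' $ j))"
  proof (rule sum.reindex_bij_witness[of _ "\<lambda>(i, j). i * n + j" "\<lambda>k. (k div n, k mod n)"],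
      goal_cases)
    case (2 k)
    then show ?case by (simp add: div_mod_less_mult)
  next
    case (4 c)
    then obtain i j where ij: "c = (i, j)" "i < m" "j < n" by auto
    \<comment> \<open>The pair \<open>(i, j)\<close> lies in the block of \<open>n\<close>
      coordinates that starts at \<open>i * n\<close>, and this block ends no later than
      \<open>m * n\<close>.\<close>
    have "i * n + j < Suc i * n" using ij by simp
    also have "\<dots> \<le> m * n" using ij by (intro mult_le_mono1) simp
    finally show ?case by (simp add: ij)
  qed auto
  also have "\<dots> = (u \<bullet> u') * (v \<bullet> v')"
    by (simp add: scalar_prod_def sum_product atLeast0LessThan sum.cartesian_product)
  finally show ?thesis .
qed

lemma row_kron_mat:
  assumes "r < dim_row A * dim_row B"
  shows "row (kron_mat A B) r = kron_vec (row A (r div dim_row B)) (row B (r mod dim_row B))"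
proof -
  note r = div_mod_less_mult[OF assms]
  show ?thesis
    using assms r by (intro eq_vecI) (auto simp: kron_mat_def kron_vec_def div_mod_less_mult)
qed

lemma dim_kron_mat [simp]:
  "dim_row (kron_mat A B) = dim_row A * dim_row B"
  "dim_col (kron_mat A B) = dim_col A * dim_col B"
  by (simp_all add: kron_mat_def)

lemma dim_beside [simp]:
  "dim_row (beside A B) = dim_row A" "dim_col (beside A B) = dim_col A + dim_col B"
  by (simp_all add: beside_def)

lemma row_beside:
  assumes "r < dim_row A" "dim_row B = dim_row A"
  shows "row (beside A B) r = row A r @\<^sub>v row B r"
  using assms by (intro eq_vecI) (auto simp: beside_def)

lemma dim_outer_prod [simp]:
  "dim_row (outer_prod u v) = dim_vec u" "dim_col (outer_prod u v) = dim_vec v"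
  by (simp_all add: outer_prod_def)

lemma outer_prod_carrier [simp]:
  "u \<in> carrier_vec m \<Longrightarrow> v \<in> carrier_vec n \<Longrightarrow> outer_prod u v \<in> carrier_mat m n"
  by (rule carrier_matI) simp_all

lemma index_outer_prod [simp]:
  "i < dim_vec u \<Longrightarrow> j < dim_vec v \<Longrightarrow> outer_prod u v $$ (i, j) = u $ i * v $ j"
  by (simp add: outer_prod_def scalar_prod_def)

lemma transpose_outer_prod:
  fixes u v :: "'a::comm_semiring_0 vec"
  shows "transpose_mat (outer_prod u v) = outer_prod v u"
  by (intro eq_matI) (auto simp: mult.commute)

text \<open>Associativity: in \<open>x (u\<^sup>T v) = (x u\<^sup>T) v\<close> the factor
  \<open>x u\<^sup>T\<close> is the scalar \<open>x \<bullet> u\<close>.\<close>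

lemma mat_of_row_mult_outer_prod:
  assumes "x \<in> carrier_vec n" "u \<in> carrier_vec n"
  shows "mat_of_row x * outer_prod u v = mat_of_row ((x \<bullet> u) \<cdot>\<^sub>v v)"
  using assms
  by (intro eq_matI) (auto simp: scalar_prod_def sum_distrib_right mult.assoc intro!: sum.cong)

section \<open>Shear matrices [I, M; 0, I]\<close>

lemma mat_of_row_append:
  "mat_of_row (u @\<^sub>v v) =
    four_block_mat (mat_of_row u) (mat_of_row v) (0\<^sub>m 0 (dim_vec u)) (0\<^sub>m 0 (dim_vec v))"
  by (intro eq_matI) auto

text \<open>Block multiplication gives [x, xM + z]. Since \<open>mat_of_row x * M\<close> is a
  matrix with one row, \<open>w\<close> names the same row as a vector, which can then be
  concatenated.\<close>

lemma mat_of_row_append_mult_shear: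
  fixes M :: "'a::semiring_1 mat"
  assumes x: "x \<in> carrier_vec n" and z: "z \<in> carrier_vec n" and M: "M \<in> carrier_mat n n"
    and w: "mat_of_row x * M = mat_of_row w" "w \<in> carrier_vec n"
  shows "mat_of_row (x @\<^sub>v z) * four_block_mat (1\<^sub>m n) M (0\<^sub>m n n) (1\<^sub>m n) =
    mat_of_row (x @\<^sub>v (w + z))"
proof -
  have [simp]: "dim_vec x = n" "dim_vec z = n" "dim_vec w = n" using assms by auto
  have c: "mat_of_row x \<in> carrier_mat 1 n" "mat_of_row z \<in> carrier_mat 1 n" by auto
  have "mat_of_row w + mat_of_row z = mat_of_row (w + z)"
    by (intro eq_matI) auto
  \<comment> \<open>The row [x, z] is read as a four-block matrix whose lower blocks have no rows,
    so that the four-block product rule applies. The lower blocks of the product are empty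
    again.\<close>
  moreover have "mat_of_row (x @\<^sub>v z) * four_block_mat (1\<^sub>m n) M (0\<^sub>m n n) (1\<^sub>m n) =
      four_block_mat (mat_of_row x * 1\<^sub>m n + mat_of_row z * 0\<^sub>m n n)
        (mat_of_row x * M + mat_of_row z * 1\<^sub>m n)
        (0\<^sub>m 0 n * 1\<^sub>m n + 0\<^sub>m 0 n * 0\<^sub>m n n) (0\<^sub>m 0 n * M + 0\<^sub>m 0 n * 1\<^sub>m n)"
    unfolding mat_of_row_append using M c
    by (simp add: mult_four_block_mat[of _ 1 n _ n _ 0 _ _ n _ n])
  ultimately show ?thesis using M c
    by (simp add: mat_of_row_append w)
qed

text \<open>By symmetry the transpose of \<open>F\<close> is [I, 0; M, I]. Hence the triple product
  is [M, I; I, 0] [I, 0; M, I] = [M + M, I; I, 0], and \<open>M + M\<close> vanishes in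
  characteristic 2.\<close>

lemma shear_symplectic:
  fixes M :: "bit mat"
  assumes M: "M \<in> carrier_mat n n" and sym: "transpose_mat M = M"
  defines "F \<equiv> four_block_mat (1\<^sub>m n) M (0\<^sub>m n n) (1\<^sub>m n)"
  shows "F * Omega n * transpose_mat F = Omega n"
proof -
  have T: "transpose_mat F = four_block_mat (1\<^sub>m n) (0\<^sub>m n n) M (1\<^sub>m n)"
    unfolding F_def using M sym by (simp add: transpose_four_block_mat[of _ n n _ n _ n])
  have "F * Omega n = four_block_mat M (1\<^sub>m n) (1\<^sub>m n) (0\<^sub>m n n)"
    unfolding F_def Omega_def using M
    by (simp add: mult_four_block_mat[of _ n n _ n _ n _ _ n _ n])
  moreover have "M + M = 0\<^sub>m n n"
    using M by (intro eq_matI) auto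
  ultimately show ?thesis
    unfolding T using M by (simp add: mult_four_block_mat[of _ n n _ n _ n _ _ n _ n] Omega_def)
qed

section \<open>The CZ shear for logical operators with dual supports\<close>

lemma X_type_plus_Z_type:
  assumes "x \<in> carrier_vec n" "z \<in> carrier_vec n"
  shows "X_type x + Z_type z = x @\<^sub>v z"
proof -
  have "dim_vec x = n" "dim_vec z = n" using assms by auto
  then show ?thesis by (intro eq_vecI) (auto simp: X_type_def Z_type_def)
qed

text \<open>This part is independent of the product structure: only the duality of the supports
  \<open>x\<close> and \<open>z\<close> and the shape of the stabilizers enter. The Z-type
  stabilizers are arbitrary because the shear fixes every Z-type vector.\<close>

lemma CZ_symplectic_rep:
  fixes n :: nat and x z :: "logical_qubit \<Rightarrow> bit vec"
  assumes pq: "p \<in> Q" "q \<in> Q" "p \<noteq> q"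
    and x: "\<And>t. t \<in> Q \<Longrightarrow> x t \<in> carrier_vec n" "\<And>t. t \<in> Q \<Longrightarrow> v (LogX t) = X_type (x t)"
    and z: "\<And>t. t \<in> Q \<Longrightarrow> z t \<in> carrier_vec n" "\<And>t. t \<in> Q \<Longrightarrow> v (LogZ t) = Z_type (z t)"
    and comm: "\<And>s t. s \<in> Q \<Longrightarrow> t \<in> Q \<Longrightarrow> x s \<bullet> z t = of_bool (s = t)"
    and S: "S \<subseteq> X_type ` {y \<in> carrier_vec n. \<forall>t\<in>Q. y \<bullet> z t = 0} \<union> Z_type ` carrier_vec n"
  shows "symplectic_rep n S Q v (logical_CZ p q)
    (four_block_mat (1\<^sub>m n) (outer_prod (z p) (z q) + outer_prod (z q) (z p)) (0\<^sub>m n n) (1\<^sub>m n))"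
proof -
  define M where "M = outer_prod (z p) (z q) + outer_prod (z q) (z p)"
  define F where "F = four_block_mat (1\<^sub>m n) M (0\<^sub>m n n) (1\<^sub>m n)"
  note zp = z(1)[OF pq(1)] and zq = z(1)[OF pq(2)]
  have M: "M \<in> carrier_mat n n" using zp zq by (simp add: M_def)
  have sym: "transpose_mat M = M"
    unfolding M_def using zp zq
    by (subst transpose_add[of _ n n])
      (auto simp: transpose_outer_prod intro!: comm_add_mat[of _ n n])
  have rowM: "mat_of_row y * M = mat_of_row ((y \<bullet> z p) \<cdot>\<^sub>v z q + (y \<bullet> z q) \<cdot>\<^sub>v z p)"
    if "y \<in> carrier_vec n" for y
  proof -
    have "mat_of_row y * M =
        mat_of_row y * outer_prod (z p) (z q) + mat_of_row y * outer_prod (z q) (z p)"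
      unfolding M_def using that zp zq by (intro mult_add_distrib_mat[of _ 1 n _ n]) auto
    also have "\<dots> = mat_of_row ((y \<bullet> z p) \<cdot>\<^sub>v z q) + mat_of_row ((y \<bullet> z q) \<cdot>\<^sub>v z p)"
      using that zp zq by (simp add: mat_of_row_mult_outer_prod)
    also have "\<dots> = mat_of_row ((y \<bullet> z p) \<cdot>\<^sub>v z q + (y \<bullet> z q) \<cdot>\<^sub>v z p)"
      using zp zq by (intro eq_matI) auto
    finally show ?thesis .
  qed
  \<comment> \<open>The image is written as a sum rather than a concatenation because
    \<open>product_vec\<close> adds the vectors of the factors.\<close>
  have FX: "mat_of_row (X_type y) * F =
      mat_of_row (X_type y + Z_type ((y \<bullet> z p) \<cdot>\<^sub>v z q + (y \<bullet> z q) \<cdot>\<^sub>v z p))"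
    if y: "y \<in> carrier_vec n" for y
  proof -
    let ?w = "(y \<bullet> z p) \<cdot>\<^sub>v z q + (y \<bullet> z q) \<cdot>\<^sub>v z p"
    have w: "?w \<in> carrier_vec n" using zp zq by simp
    have "X_type y = y @\<^sub>v 0\<^sub>v n" using y by (simp add: X_type_def)
    moreover have "?w + 0\<^sub>v n = ?w" using w by (rule right_zero_vec)
    ultimately show ?thesis
      using mat_of_row_append_mult_shear[OF y zero_carrier_vec M rowM[OF y] w]
      unfolding F_def X_type_plus_Z_type[OF y w] by (simp only:)
  qed
  have FZ: "mat_of_row (Z_type y) * F = mat_of_row (Z_type y)" if y: "y \<in> carrier_vec n" for y
  proof -
    have "mat_of_row (0\<^sub>v n) * M = mat_of_row (0\<^sub>v n)"
      using M by (intro eq_matI) auto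
    then show ?thesis
      using mat_of_row_append_mult_shear[OF zero_carrier_vec y M _ zero_carrier_vec] y
      by (simp add: F_def Z_type_def)
  qed
  have X0: "X_type y + Z_type (0\<^sub>v n) = X_type y" if "y \<in> carrier_vec n" for y
    using that by (simp add: X_type_plus_Z_type[of _ n]) (simp add: X_type_def)
  have carr: "X_type y \<in> carrier_vec (2 * n)" "Z_type y \<in> carrier_vec (2 * n)"
    if "y \<in> carrier_vec n" for y
    using that by (auto simp: X_type_def Z_type_def intro!: carrier_vecI)
  have "mat_of_row s * F = mat_of_row s" if s: "s \<in> S" for s
  proof (cases "s \<in> Z_type ` carrier_vec n")
    case False
    then obtain y where y: "s = X_type y" "y \<in> carrier_vec n" "y \<bullet> z p = 0" "y \<bullet> z q = 0"
      using S s pq by auto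
    have "0 \<cdot>\<^sub>v z q + 0 \<cdot>\<^sub>v z p = 0\<^sub>v n" using zp zq by (intro eq_vecI) auto
    then show ?thesis using y X0 by (simp add: FX)
  qed (auto simp: FZ)
  moreover have "mat_of_row (v (LogX t)) * F = mat_of_row (product_vec n v (logical_CZ p q (LogX t)))"
    if t: "t \<in> Q" for t
  proof -
    \<comment> \<open>By duality and \<open>p \<noteq> q\<close> at most one coefficient is 1: the
      operator X on one target picks up the Z of the other target, and all other X are
      unchanged.\<close>
    have "(x t \<bullet> z p) \<cdot>\<^sub>v z q + (x t \<bullet> z q) \<cdot>\<^sub>v z p =
        (if t = p then z q else if t = q then z p else 0\<^sub>v n)"
      using t pq zp zq by (auto simp: comm intro!: eq_vecI)
    then have "mat_of_row (v (LogX t)) * F = mat_of_row (X_type (x t) +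
        Z_type (if t = p then z q else if t = q then z p else 0\<^sub>v n))"
      using t x FX by simp
    \<comment> \<open>For \<open>t = q\<close> the gate lists the factor \<open>LogZ p\<close>
      before \<open>LogX q\<close>, so the two summands have to be exchanged.\<close>
    then show ?thesis
      using t pq x z X0 carr comm_add_vec[of "X_type (x q)" "2 * n" "Z_type (z p)"]
      by (auto simp: logical_CZ_def product_vec_def)
  qed
  moreover have "mat_of_row (v (LogZ t)) * F = mat_of_row (product_vec n v (logical_CZ p q (LogZ t)))"
    if t: "t \<in> Q" for t
    using t z FZ carr by (auto simp: logical_CZ_def product_vec_def)
  moreover have "F \<in> carrier_mat (2 * n) (2 * n)"
    using M by (simp add: F_def mult_2)
  ultimately show ?thesis
    using shear_symplectic[OF M sym]
    unfolding symplectic_rep_def F_def[symmetric] M_def[symmetric] by auto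
qed

section \<open>SLT bases and the supports in the hypergraph product code\<close>

lemma SLT_basis_kernel:
  assumes "A \<in> carrier_mat m n" "SLT_basis n (mat_kernel A) P a" "i \<in> P"
  shows "a i \<in> carrier_vec n" "A *\<^sub>v a i = 0\<^sub>v m" "i < n"
proof -
  \<comment> \<open>This makes the kernel available as the vector space \<open>Ker\<close>, so that
    \<open>Ker.basis_def\<close> yields that basis vectors lie in it.\<close>
  interpret kernel m n A by unfold_locales (rule assms)
  have "a i \<in> mat_kernel A"
    using assms(2,3) unfolding SLT_basis_def Ker.basis_def by auto
  then show "a i \<in> carrier_vec n" "A *\<^sub>v a i = 0\<^sub>v m"
    using assms(1) by (auto simp: mat_kernel_def)
  show "i < n" using assms(2,3) by (auto simp: SLT_basis_def)
qed

lemma SLT_basis_pivots: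
  "SLT_basis n V P a \<Longrightarrow> i \<in> P \<Longrightarrow> i' \<in> P \<Longrightarrow> a i' $ i = of_bool (i = i')"
  by (auto simp: SLT_basis_def)

lemma append_scalar_prod_zero:
  fixes x\<^sub>1 x\<^sub>2 u :: "'a::semiring_0 vec"
  assumes "x\<^sub>1 \<in> carrier_vec m" "x\<^sub>2 \<in> carrier_vec n"
  shows "u \<in> carrier_vec m \<Longrightarrow> (x\<^sub>1 @\<^sub>v x\<^sub>2) \<bullet> (u @\<^sub>v 0\<^sub>v n) = x\<^sub>1 \<bullet> u"
    and "u \<in> carrier_vec n \<Longrightarrow> (x\<^sub>1 @\<^sub>v x\<^sub>2) \<bullet> (0\<^sub>v m @\<^sub>v u) = x\<^sub>2 \<bullet> u"
  using assms by (simp_all add: scalar_prod_append)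

text \<open>The Z half of \<open>logical_vec\<close> at \<open>LogZ t\<close>, with the sector sizes
  as explicit parameters instead of dimensions of the check matrices.\<close>

fun logical_Z_support :: "nat \<Rightarrow> nat \<Rightarrow> nat \<Rightarrow> nat \<Rightarrow> (nat \<Rightarrow> bit vec) \<Rightarrow> (nat \<Rightarrow> bit vec) \<Rightarrow>
    logical_qubit \<Rightarrow> bit vec" where
  "logical_Z_support ma na mb nb a \<beta> (LeftQ i h) =
     kron_vec (a i) (unit_vec nb h) @\<^sub>v 0\<^sub>v (ma * mb)"
| "logical_Z_support ma na mb nb a \<beta> (RightQ j l) =
     0\<^sub>v (na * nb) @\<^sub>v kron_vec (unit_vec ma j) (\<beta> l)"

lemma hgp_CZ_symplectic_rep:
  fixes Ha Hb :: "bit mat"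
  assumes Ha: "Ha \<in> carrier_mat ma na"
    and Hb: "Hb \<in> carrier_mat mb nb"
    and a: "SLT_basis na (mat_kernel Ha) Pa a"
    and \<alpha>: "SLT_basis ma (mat_kernel (transpose_mat Ha)) P\<alpha> \<alpha>"
    and b: "SLT_basis nb (mat_kernel Hb) Pb b"
    and \<beta>: "SLT_basis mb (mat_kernel (transpose_mat Hb)) P\<beta> \<beta>"
    and pq: "p \<in> logical_qubits Pa P\<alpha> Pb P\<beta>" "q \<in> logical_qubits Pa P\<alpha> Pb P\<beta>" "p \<noteq> q"
  defines "n \<equiv> na * nb + ma * mb"
    and "z \<equiv> logical_Z_support ma na mb nb a \<beta>"
  shows "hgp_symplectic_rep Ha Hb Pa a P\<alpha> \<alpha> Pb b P\<beta> \<beta> (logical_CZ p q)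
    (four_block_mat (1\<^sub>m n) (outer_prod (z p) (z q) + outer_prod (z q) (z p)) (0\<^sub>m n n) (1\<^sub>m n))"
proof -
  let ?Q = "logical_qubits Pa P\<alpha> Pb P\<beta>" and ?v = "logical_vec Ha Hb a \<alpha> b \<beta>"
  define x where "x = (\<lambda>t. case t of
      LeftQ i h \<Rightarrow> kron_vec (unit_vec na i) (b h) @\<^sub>v 0\<^sub>v (ma * mb)
    | RightQ j l \<Rightarrow> 0\<^sub>v (na * nb) @\<^sub>v kron_vec (\<alpha> j) (unit_vec mb l))"
  have [simp]: "dim_row Ha = ma" "dim_col Ha = na" "dim_row Hb = mb" "dim_col Hb = nb"
    using Ha Hb by auto
  note a' = SLT_basis_kernel[OF Ha a] and b' = SLT_basis_kernel[OF Hb b]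
    and \<alpha>' = SLT_basis_kernel[OF _ \<alpha>, of na] and \<beta>' = SLT_basis_kernel[OF _ \<beta>, of nb]
  have T: "transpose_mat Ha \<in> carrier_mat na ma" "transpose_mat Hb \<in> carrier_mat nb mb"
    using Ha Hb by auto
  note \<alpha>' = \<alpha>'[OF T(1)] and \<beta>' = \<beta>'[OF T(2)]
  note carr = a'(1) b'(1) \<alpha>'(1) \<beta>'(1)
  have num: "num_left Ha Hb = na * nb" "num_right Ha Hb = ma * mb" "num_qubits Ha Hb = n"
    by (simp_all add: num_left_def num_right_def num_qubits_def n_def)
  have x: "x t \<in> carrier_vec n" "?v (LogX t) = X_type (x t)" if "t \<in> ?Q" for t
    using that carr by (auto simp: logical_qubits_def x_def n_def num)
  have z: "z t \<in> carrier_vec n" "?v (LogZ t) = Z_type (z t)" if "t \<in> ?Q" for t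
    using that carr by (auto simp: logical_qubits_def z_def n_def num)
  \<comment> \<open>Supports in different sectors are disjoint. Within a sector the product factors
    into an entry of one basis vector and an entry of another, both taken at pivots, so the SLT
    conditions give 0 or 1.\<close>
  have comm: "x s \<bullet> z t = of_bool (s = t)" if "s \<in> ?Q" "t \<in> ?Q" for s t
  proof -
    have "kron_vec (unit_vec na i) (b h) \<bullet> kron_vec (a i') (unit_vec nb h') =
        of_bool (i = i' \<and> h = h')" if "i \<in> Pa" "h \<in> Pb" "i' \<in> Pa" "h' \<in> Pb" for i h i' h'
      using that a' b' SLT_basis_pivots[OF a] SLT_basis_pivots[OF b]
      by (subst scalar_prod_kron_vec[of _ na _ _ nb]) auto
    moreover have "kron_vec (\<alpha> j) (unit_vec mb l) \<bullet> kron_vec (unit_vec ma j') (\<beta> l') =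
        of_bool (j = j' \<and> l = l')" if "j \<in> P\<alpha>" "l \<in> P\<beta>" "j' \<in> P\<alpha>" "l' \<in> P\<beta>" for j l j' l'
      using that \<alpha>' \<beta>' SLT_basis_pivots[OF \<alpha>] SLT_basis_pivots[OF \<beta>]
      by (subst scalar_prod_kron_vec[of _ ma _ _ mb]) auto
    ultimately show ?thesis
      using that carr
      by (auto simp: logical_qubits_def x_def z_def append_scalar_prod_zero[of _ "na * nb" _ "ma * mb"])
  qed
  have HX: "row (hgp_HX Ha Hb) r \<bullet> z t = 0" if r: "r < ma * nb" and t: "t \<in> ?Q" for r t
  proof -
    have lt: "r div nb < ma" "r mod nb < nb"
      using div_mod_less_mult[OF r] by auto
    \<comment> \<open>The second Kronecker factors, the identity of size \<open>nb\<close> and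
      \<open>transpose_mat Hb\<close>, both have \<open>nb\<close> rows, so \<open>r\<close> decodes
      to the same pair of indices in both blocks.\<close>
    have row: "row (hgp_HX Ha Hb) r = kron_vec (row Ha (r div nb)) (unit_vec nb (r mod nb)) @\<^sub>v
        kron_vec (unit_vec ma (r div nb)) (row (transpose_mat Hb) (r mod nb))"
      using r lt by (simp add: hgp_HX_def row_beside row_kron_mat)
    have c: "kron_vec (row Ha (r div nb)) (unit_vec nb (r mod nb)) \<in> carrier_vec (na * nb)"
      "kron_vec (unit_vec ma (r div nb)) (row (transpose_mat Hb) (r mod nb)) \<in> carrier_vec (ma * mb)"
      by (auto intro!: carrier_vecI)
    \<comment> \<open>This is one entry of \<open>Ha *\<^sub>v a i = 0\<^sub>v ma\<close>. It
      annihilates the left-sector supports; the analogous entry for \<beta> annihilates the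
      right-sector ones.\<close>
    have "row Ha (r div nb) \<bullet> a i = 0" if "i \<in> Pa" for i
      using arg_cong[OF a'(2)[OF that], of "\<lambda>w. w $ (r div nb)"] lt by simp
    moreover have "row (transpose_mat Hb) (r mod nb) \<bullet> \<beta> l = 0" if "l \<in> P\<beta>" for l
      using arg_cong[OF \<beta>'(2)[OF that], of "\<lambda>w. w $ (r mod nb)"] lt by simp
    moreover have "row Ha (r div nb) \<in> carrier_vec na"
      "row (transpose_mat Hb) (r mod nb) \<in> carrier_vec mb"
      by (auto intro!: carrier_vecI)
    \<comment> \<open>Deleting \<open>row_transpose\<close> keeps the rows of
      \<open>transpose_mat Hb\<close> in the form used in \<open>c\<close> and in the orthogonality
      facts.\<close>
    ultimately show ?thesis
      using t carr
      by (auto simp: logical_qubits_def z_def row append_scalar_prod_zero[OF c]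
          scalar_prod_kron_vec[of _ na _ _ nb] scalar_prod_kron_vec[of _ ma _ _ mb] simp del: row_transpose)
  qed
  have dims: "dim_row (hgp_HX Ha Hb) = ma * nb" "dim_col (hgp_HX Ha Hb) = n"
    "dim_col (hgp_HZ Ha Hb) = n"
    by (simp_all add: hgp_HX_def hgp_HZ_def n_def)
  have "hgp_stabilizers Ha Hb \<subseteq>
      X_type ` {y \<in> carrier_vec n. \<forall>t\<in>?Q. y \<bullet> z t = 0} \<union> Z_type ` carrier_vec n"
  proof
    fix s assume "s \<in> hgp_stabilizers Ha Hb"
    then consider r where "r < ma * nb" "s = X_type (row (hgp_HX Ha Hb) r)"
      | r where "s = Z_type (row (hgp_HZ Ha Hb) r)"
      unfolding hgp_stabilizers_def dims by blast
    then show "s \<in> X_type ` {y \<in> carrier_vec n. \<forall>t\<in>?Q. y \<bullet> z t = 0} \<union> Z_type ` carrier_vec n"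
    proof cases
      case 1
      then show ?thesis using HX row_carrier[of "hgp_HX Ha Hb"] unfolding dims by blast
    next
      case 2
      then show ?thesis using row_carrier[of "hgp_HZ Ha Hb"] unfolding dims by blast
    qed
  qed
  then show ?thesis
    unfolding hgp_symplectic_rep_def num using CZ_symplectic_rep[OF pq x z comm] by simp
qed

section \<open>Identification of the two displayed matrices with the shear\<close>

theorem proposition4p9:
  fixes Ha Hb :: "bit mat"
    and ma na mb nb :: nat
    and Pa P\<alpha> Pb P\<beta> :: "nat set"
    and a \<alpha> b \<beta> :: "nat \<Rightarrow> bit vec"
  assumes Ha: "Ha \<in> carrier_mat ma na"
    and Hb: "Hb \<in> carrier_mat mb nb"
    and a: "SLT_basis na (mat_kernel Ha) Pa a"
    and \<alpha>: "SLT_basis ma (mat_kernel (transpose_mat Ha)) P\<alpha> \<alpha>"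
    and b: "SLT_basis nb (mat_kernel Hb) Pb b"
    and \<beta>: "SLT_basis mb (mat_kernel (transpose_mat Hb)) P\<beta> \<beta>"
  shows
    "(\<forall>i\<^sub>1\<in>Pa. \<forall>h\<^sub>1\<in>Pb. \<forall>i\<^sub>2\<in>Pa. \<forall>h\<^sub>2\<in>Pb. (i\<^sub>1, h\<^sub>1) \<noteq> (i\<^sub>2, h\<^sub>2) \<longrightarrow>
       (let nl = na * nb; mr = ma * mb;
            u\<^sub>1 = kron_vec (a i\<^sub>1) (unit_vec nb h\<^sub>1);
            u\<^sub>2 = kron_vec (a i\<^sub>2) (unit_vec nb h\<^sub>2);
            B = outer_prod u\<^sub>1 u\<^sub>2 + outer_prod u\<^sub>2 u\<^sub>1
        in hgp_symplectic_rep Ha Hb Pa a P\<alpha> \<alpha> Pb b P\<beta> \<beta>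
             (logical_CZ (LeftQ i\<^sub>1 h\<^sub>1) (LeftQ i\<^sub>2 h\<^sub>2))
             (four_block_mat
               (four_block_mat (1\<^sub>m nl) (0\<^sub>m nl mr) (0\<^sub>m mr nl) (1\<^sub>m mr))
               (four_block_mat B (0\<^sub>m nl mr) (0\<^sub>m mr nl) (0\<^sub>m mr mr))
               (four_block_mat (0\<^sub>m nl nl) (0\<^sub>m nl mr) (0\<^sub>m mr nl) (0\<^sub>m mr mr))
               (four_block_mat (1\<^sub>m nl) (0\<^sub>m nl mr) (0\<^sub>m mr nl) (1\<^sub>m mr)))))
     \<and>
     (\<forall>i\<in>Pa. \<forall>h\<in>Pb. \<forall>j\<in>P\<alpha>. \<forall>l\<in>P\<beta>.
       (let nl = na * nb; mr = ma * mb;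
            B = outer_prod (kron_vec (a i) (unit_vec nb h)) (kron_vec (unit_vec ma j) (\<beta> l))
        in hgp_symplectic_rep Ha Hb Pa a P\<alpha> \<alpha> Pb b P\<beta> \<beta>
             (logical_CZ (LeftQ i h) (RightQ j l))
             (four_block_mat
               (four_block_mat (1\<^sub>m nl) (0\<^sub>m nl mr) (0\<^sub>m mr nl) (1\<^sub>m mr))
               (four_block_mat (0\<^sub>m nl nl) B (transpose_mat B) (0\<^sub>m mr mr))
               (four_block_mat (0\<^sub>m nl nl) (0\<^sub>m nl mr) (0\<^sub>m mr nl) (0\<^sub>m mr mr))
               (four_block_mat (1\<^sub>m nl) (0\<^sub>m nl mr) (0\<^sub>m mr nl) (1\<^sub>m mr)))))"
proof (intro conjI ballI impI; unfold Let_def)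
  let ?nl = "na * nb" and ?mr = "ma * mb"
  note rep = hgp_CZ_symplectic_rep[OF assms]
  \<comment> \<open>Three of the four nested blocks collapse to an identity or zero matrix of size
    n; only the upper right one depends on the targets.\<close>
  have one: "four_block_mat (1\<^sub>m ?nl) (0\<^sub>m ?nl ?mr) (0\<^sub>m ?mr ?nl) (1\<^sub>m ?mr) =
      (1\<^sub>m (?nl + ?mr) :: bit mat)"
    and zero: "four_block_mat (0\<^sub>m ?nl ?nl) (0\<^sub>m ?nl ?mr) (0\<^sub>m ?mr ?nl) (0\<^sub>m ?mr ?mr) =
      (0\<^sub>m (?nl + ?mr) (?nl + ?mr) :: bit mat)"
    by (auto intro!: eq_matI)
  {
    fix i\<^sub>1 h\<^sub>1 i\<^sub>2 h\<^sub>2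
    assume piv: "i\<^sub>1 \<in> Pa" "h\<^sub>1 \<in> Pb" "i\<^sub>2 \<in> Pa" "h\<^sub>2 \<in> Pb" and ne: "(i\<^sub>1, h\<^sub>1) \<noteq> (i\<^sub>2, h\<^sub>2)"
    let ?u\<^sub>1 = "kron_vec (a i\<^sub>1) (unit_vec nb h\<^sub>1)" and ?u\<^sub>2 = "kron_vec (a i\<^sub>2) (unit_vec nb h\<^sub>2)"
    let ?B = "outer_prod ?u\<^sub>1 ?u\<^sub>2 + outer_prod ?u\<^sub>2 ?u\<^sub>1"
    have d: "dim_vec (a i\<^sub>1) = na" "dim_vec (a i\<^sub>2) = na"
      using SLT_basis_kernel(1)[OF Ha a] piv by auto
    \<comment> \<open>Both supports vanish on the right sector, which confines the outer products to
      the upper left block.\<close>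
    have "outer_prod (?u\<^sub>1 @\<^sub>v 0\<^sub>v ?mr) (?u\<^sub>2 @\<^sub>v 0\<^sub>v ?mr) + outer_prod (?u\<^sub>2 @\<^sub>v 0\<^sub>v ?mr) (?u\<^sub>1 @\<^sub>v 0\<^sub>v ?mr) =
        four_block_mat ?B (0\<^sub>m ?nl ?mr) (0\<^sub>m ?mr ?nl) (0\<^sub>m ?mr ?mr)"
      by (intro eq_matI) (auto simp: d)
    then show "hgp_symplectic_rep Ha Hb Pa a P\<alpha> \<alpha> Pb b P\<beta> \<beta>
        (logical_CZ (LeftQ i\<^sub>1 h\<^sub>1) (LeftQ i\<^sub>2 h\<^sub>2))
        (four_block_mat
          (four_block_mat (1\<^sub>m ?nl) (0\<^sub>m ?nl ?mr) (0\<^sub>m ?mr ?nl) (1\<^sub>m ?mr))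
          (four_block_mat ?B (0\<^sub>m ?nl ?mr) (0\<^sub>m ?mr ?nl) (0\<^sub>m ?mr ?mr))
          (four_block_mat (0\<^sub>m ?nl ?nl) (0\<^sub>m ?nl ?mr) (0\<^sub>m ?mr ?nl) (0\<^sub>m ?mr ?mr))
          (four_block_mat (1\<^sub>m ?nl) (0\<^sub>m ?nl ?mr) (0\<^sub>m ?mr ?nl) (1\<^sub>m ?mr)))"
      using rep[of "LeftQ i\<^sub>1 h\<^sub>1" "LeftQ i\<^sub>2 h\<^sub>2"] piv ne
      by (simp add: one zero logical_qubits_def)
  next
    fix i h j l
    assume piv: "i \<in> Pa" "h \<in> Pb" "j \<in> P\<alpha>" "l \<in> P\<beta>"
    let ?u = "kron_vec (a i) (unit_vec nb h)" and ?w = "kron_vec (unit_vec ma j) (\<beta> l)"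
    let ?B = "outer_prod ?u ?w"
    have d: "dim_vec (a i) = na" "dim_vec (\<beta> l) = mb"
      using SLT_basis_kernel(1)[OF Ha a] SLT_basis_kernel(1)[OF _ \<beta>, of nb] Hb piv by auto
    \<comment> \<open>The supports lie in different sectors, so the two outer products fill opposite
      off-diagonal blocks and are transposes of each other.\<close>
    have "outer_prod (?u @\<^sub>v 0\<^sub>v ?mr) (0\<^sub>v ?nl @\<^sub>v ?w) + outer_prod (0\<^sub>v ?nl @\<^sub>v ?w) (?u @\<^sub>v 0\<^sub>v ?mr) =
        four_block_mat (0\<^sub>m ?nl ?nl) ?B (transpose_mat ?B) (0\<^sub>m ?mr ?mr)"
      by (intro eq_matI) (auto simp: d)
    then show "hgp_symplectic_rep Ha Hb Pa a P\<alpha> \<alpha> Pb b P\<beta> \<beta>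
        (logical_CZ (LeftQ i h) (RightQ j l))
        (four_block_mat
          (four_block_mat (1\<^sub>m ?nl) (0\<^sub>m ?nl ?mr) (0\<^sub>m ?mr ?nl) (1\<^sub>m ?mr))
          (four_block_mat (0\<^sub>m ?nl ?nl) ?B (transpose_mat ?B) (0\<^sub>m ?mr ?mr))
          (four_block_mat (0\<^sub>m ?nl ?nl) (0\<^sub>m ?nl ?mr) (0\<^sub>m ?mr ?nl) (0\<^sub>m ?mr ?mr))
          (four_block_mat (1\<^sub>m ?nl) (0\<^sub>m ?nl ?mr) (0\<^sub>m ?mr ?nl) (1\<^sub>m ?mr)))"
      using rep[of "LeftQ i h" "RightQ j l"] piv
      by (simp add: one zero logical_qubits_def)
  }
qed

end
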